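(* Let $(A,\ominus)$ be a $\ominus$-algebra with extended dual space $(X,i,+,\star)$. Assume further that $\neg$ is an involution, that the operation $a\oplus b:=\neg(\neg a\ominus b)$ is a right residual of $\ominus$ (that is, $a\leq b\oplus c\iff a\ominus c\leq b$ for all $a,b,c\in A$), and that $\oplus$ is commutative. The following are equivalent: 1. for all $a,b\in A$, $a\wedge b=a\ominus(a\ominus b)$; 2. for all $x,x',y\in X$, if $(x,y)\in\mathrm{dom}(\star)$, and there exists $w\in X$ with $w\nleq y$ such that $x'+w\leq x\star y$, then $x'\leq x$.
   Context: **$\ominus$-algebras.** A $\ominus$-algebra $(A,\ominus)$ is a bounded distributive lattice $A$ with a binary operation $\ominus$ such that for all $a,b,c\in A$: (1) $(a\wedge b)\ominus c=(a\ominus c)\wedge(b\ominus c)$, $(a\vee b)\ominus c=(a\ominus c)\vee(b\ominus c)$, $a\ominus(b\wedge c)=(a\ominus b)\vee(a\ominus c)$, $a\ominus(b\vee c)=(a\ominus b)\wedge(a\ominus c)$; (2) $0\ominus a=0$ and $a\ominus 1=0$; (3) $a\ominus 0=a$. Its negation is $\neg a:=1\ominus a$. **Canonical extension.** A complete lattice is doubly algebraic if it and its opposite are algebraic. The canonical extension $A^\delta$ of $A$ is the doubly algebraic distributive lattice (unique up to isomorphism fixing $A$) containing $A$ as a bounded sublattice such that every completely join-irreducible element of $A^\delta$ is a meet of elements of $A$, and such that $\bigwedge S\leq\bigvee T$ with $S,T\subseteq A$ implies $\bigwedge S'\leq\bigvee T'$ for some finite $S'\subseteq S$, $T'\subseteq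 T$. Here $u$ is completely join-irreducible (resp. completely meet-irreducible) if $u=\bigvee S$ (resp. $u=\bigwedge S$) implies $u\in S$; these elements form the posets $J^\infty(A^\delta)$, $M^\infty(A^\delta)$, and $\kappa\colon J^\infty(A^\delta)\to M^\infty(A^\delta)$, $\kappa(j)=\bigvee\{u\in A^\delta\mid j\nleq u\}$, is an order isomorphism. $F(A^\delta)$ (filter elements) and $I(A^\delta)$ (ideal elements) are the sets of arbitrary meets, resp. joins, of elements of $A$. For $u,v\in A^\delta$, $u\ominus^\sigma v=\bigvee\bigwedge\{a\ominus b\mid a\in[p_1,q_1]\cap A,\ b\in[p_2,q_2]\cap A\}$ and $u\ominus^\pi v=\bigwedge\bigvee\{a\ominus b\mid a\in[p_1,q_1]\cap A,\ b\in[p_2,q_2]\cap A\}$, where the outer join/meet ranges over all $p_1,p_2\in F(A^\delta)$, $q_1,q_2\in I(A^\delta)$ with $p_1\leq u\leq q_1$, $p_2\leq v\leq q_2$. The $\sigma$- and $\pi$-extensions of $\neg$ (defined analogously) coincide; their common value is $\neg^\delta$. **Dual space.** The dual space $X$ of $A$ is the Priestley space of $A$, e.g. the set of prime ideals of $A$ ordered by inclusion, writing $I_x$ for the prime ideal corresponding to $x\in X$ and $F_x=A\setminus I_x$; the topology is generated by the sets $\widehat a=\{x\in X\mid a\notin I_x\}$ ($a\in A$) and their complements, and $a\mapsto\widehat a$ is an isomorphism of $A$ onto the lattice of clopen down-sets of $X$. There are order isomorphisms $\mu\colon X\to M^\infty(A^\delta)$, $\mu(x)=\bigvee I_x$, and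 $\nu\colon X\to J^\infty(A^\delta)$, $\nu(x)=\bigwedge F_x$, with $\kappa(\nu(x))=\mu(x)$. **Extended dual space.** The map $i\colon X\to X$ is the continuous order-reversing map determined by $I_{i(x)}=\{a\in A\mid\neg a\in F_x\}$. For $y\in X$, $\ominus^{\sigma\sharp}$ is determined by $u\ominus^\sigma\mu(y)\leq v\iff u\leq v\ominus^{\sigma\sharp}\mu(y)$ ($u,v\in A^\delta$), and, for $u\leq\neg^\delta\nu(y)$, $\ominus^{\pi\flat}$ is determined by $u\leq v\ominus^\pi\nu(y)\iff u\ominus^{\pi\flat}\nu(y)\leq v$ ($v\in A^\delta$). Define partial operations on $X$: $\mathrm{dom}(+)=\{(x,y)\mid y\leq i(x)\}$, $x+y=\mu^{-1}(\mu(x)\ominus^{\sigma\sharp}\mu(y))$; $\mathrm{dom}(\star)=\{(x,y)\mid i(x)\nleq y\}$, $x\star y=\nu^{-1}(\nu(x)\ominus^{\pi\flat}\nu(y))$ (these are well defined). The extended dual space of $(A,\ominus)$ is $(X,i,+,\star)$. An inequality involving partial terms asserts in particular that the terms are defined; so "$x'+w\leq x\star y$" includes $(x',w)\in\mathrm{dom}(+)$. *)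

theory Defs
  imports Main
begin

section \<open>\<open>\<ominus>\<close>-algebras\<close>

locale ominus_algebra =
  fixes ominus :: "'a::{distrib_lattice,bounded_lattice} \<Rightarrow> 'a \<Rightarrow> 'a"  (infixl \<open>\<ominus>\<close> 65)
  assumes inf_ominus: "inf a b \<ominus> c = inf (a \<ominus> c) (b \<ominus> c)"
    and sup_ominus: "sup a b \<ominus> c = sup (a \<ominus> c) (b \<ominus> c)"
    and ominus_inf: "a \<ominus> inf b c = sup (a \<ominus> b) (a \<ominus> c)"
    and ominus_sup: "a \<ominus> sup b c = inf (a \<ominus> b) (a \<ominus> c)"
    and bot_ominus: "bot \<ominus> a = bot"
    and ominus_top: "a \<ominus> top = bot"
    and ominus_bot: "a \<ominus> bot = a"

definition oneg :: "('a::bounded_lattice \<Rightarrow> 'a \<Rightarrow> 'a) \<Rightarrow> 'a \<Rightarrow> 'a" where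
  "oneg m a = m top a"

definition oplus :: "('a::bounded_lattice \<Rightarrow> 'a \<Rightarrow> 'a) \<Rightarrow> 'a \<Rightarrow> 'a \<Rightarrow> 'a" where
  "oplus m a b = oneg m (m (oneg m a) b)"


section \<open>Canonical extensions\<close>

definition compact_element :: "'d::complete_lattice \<Rightarrow> bool" where
  "compact_element c \<longleftrightarrow> (\<forall>S. c \<le> Sup S \<longrightarrow> (\<exists>T. finite T \<and> T \<subseteq> S \<and> c \<le> Sup T))"

definition cocompact_element :: "'d::complete_lattice \<Rightarrow> bool" where
  "cocompact_element c \<longleftrightarrow> (\<forall>S. Inf S \<le> c \<longrightarrow> (\<exists>T. finite T \<and> T \<subseteq> S \<and> Inf T \<le> c))"

text \<open>The first conjunct says that the lattice is algebraic, the second that its opposite is.\<close>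

definition doubly_algebraic :: "'d::complete_lattice itself \<Rightarrow> bool" where
  "doubly_algebraic _ \<longleftrightarrow>
     (\<forall>u::'d. \<exists>C. (\<forall>c\<in>C. compact_element c) \<and> u = Sup C) \<and>
     (\<forall>u::'d. \<exists>C. (\<forall>c\<in>C. cocompact_element c) \<and> u = Inf C)"

definition completely_join_irreducible :: "'d::complete_lattice \<Rightarrow> bool" where
  "completely_join_irreducible u \<longleftrightarrow> (\<forall>S. u = Sup S \<longrightarrow> u \<in> S)"

text \<open>
  The canonical extension of \<open>A\<close> is only determined up to isomorphism, so it is treated as an
  arbitrary type \<open>'d\<close> together with an embedding \<open>e\<close> having the defining properties. The
  inclusion \<open>A \<subseteq> A\<^sup>\<delta>\<close> is the map \<open>e\<close>.
\<close>

locale canonical_extension =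
  fixes e :: "'a::{distrib_lattice,bounded_lattice} \<Rightarrow> 'd::{complete_lattice,distrib_lattice}"
  assumes doubly_algebraic: "doubly_algebraic TYPE('d)"
    and inj_e: "inj e"
    and e_inf: "e (inf a b) = inf (e a) (e b)"
    and e_sup: "e (sup a b) = sup (e a) (e b)"
    and e_bot: "e bot = bot"
    and e_top: "e top = top"
    and join_irreducible_meet:
      "completely_join_irreducible j \<Longrightarrow> \<exists>S. j = Inf (e ` S)"
    and compactness:
      "Inf (e ` S) \<le> Sup (e ` T) \<Longrightarrow>
         \<exists>S' T'. finite S' \<and> S' \<subseteq> S \<and> finite T' \<and> T' \<subseteq> T \<and> Inf (e ` S') \<le> Sup (e ` T')"

definition filter_elements :: "('a \<Rightarrow> 'd::complete_lattice) \<Rightarrow> 'd set" where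
  "filter_elements e = {Inf (e ` S) | S. True}"

definition ideal_elements :: "('a \<Rightarrow> 'd::complete_lattice) \<Rightarrow> 'd set" where
  "ideal_elements e = {Sup (e ` S) | S. True}"

definition sigma_ext ::
  "('a \<Rightarrow> 'd::complete_lattice) \<Rightarrow> ('a \<Rightarrow> 'a \<Rightarrow> 'a) \<Rightarrow> 'd \<Rightarrow> 'd \<Rightarrow> 'd" where
  "sigma_ext e m u v =
     Sup {Inf {e (m a b) | a b. e a \<in> {p1..q1} \<and> e b \<in> {p2..q2}} | p1 q1 p2 q2.
            p1 \<in> filter_elements e \<and> p2 \<in> filter_elements e \<and>
            q1 \<in> ideal_elements e \<and> q2 \<in> ideal_elements e \<and>
            p1 \<le> u \<and> u \<le> q1 \<and> p2 \<le> v \<and> v \<le> q2}"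

definition pi_ext ::
  "('a \<Rightarrow> 'd::complete_lattice) \<Rightarrow> ('a \<Rightarrow> 'a \<Rightarrow> 'a) \<Rightarrow> 'd \<Rightarrow> 'd \<Rightarrow> 'd" where
  "pi_ext e m u v =
     Inf {Sup {e (m a b) | a b. e a \<in> {p1..q1} \<and> e b \<in> {p2..q2}} | p1 q1 p2 q2.
            p1 \<in> filter_elements e \<and> p2 \<in> filter_elements e \<and>
            q1 \<in> ideal_elements e \<and> q2 \<in> ideal_elements e \<and>
            p1 \<le> u \<and> u \<le> q1 \<and> p2 \<le> v \<and> v \<le> q2}"

text \<open>
  The adjoints \<open>\<ominus>\<^sup>\<sigma>\<^sup>\<sharp>\<close> and \<open>\<ominus>\<^sup>\<pi>\<^sup>\<flat>\<close> are the unique elements satisfying their adjunction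
  conditions. The first is meaningful when its second argument is \<open>\<mu>(y)\<close>. The second is meaningful
  when \<open>n = \<nu>(y)\<close> and \<open>u \<le> \<not>\<^sup>\<delta> \<nu>(y)\<close>; the latter is necessary, since \<open>v = top\<close> in the condition
  gives \<open>u \<le> top \<ominus>\<^sup>\<pi> \<nu>(y) = \<not>\<^sup>\<delta> \<nu>(y)\<close>.
\<close>

definition sigma_sharp ::
  "('a \<Rightarrow> 'd::complete_lattice) \<Rightarrow> ('a \<Rightarrow> 'a \<Rightarrow> 'a) \<Rightarrow> 'd \<Rightarrow> 'd \<Rightarrow> 'd" where
  "sigma_sharp e m v n = (THE w. \<forall>u. sigma_ext e m u n \<le> v \<longleftrightarrow> u \<le> w)"

definition pi_flat ::
  "('a \<Rightarrow> 'd::complete_lattice) \<Rightarrow> ('a \<Rightarrow> 'a \<Rightarrow> 'a) \<Rightarrow> 'd \<Rightarrow> 'd \<Rightarrow> 'd" where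
  "pi_flat e m u n = (THE w. \<forall>v. u \<le> pi_ext e m v n \<longleftrightarrow> w \<le> v)"


section \<open>The extended dual space\<close>

definition prime_ideal :: "'a::lattice set \<Rightarrow> bool" where
  "prime_ideal I \<longleftrightarrow>
     I \<noteq> {} \<and> I \<noteq> UNIV \<and>
     (\<forall>a b. a \<le> b \<longrightarrow> b \<in> I \<longrightarrow> a \<in> I) \<and>
     (\<forall>a\<in>I. \<forall>b\<in>I. sup a b \<in> I) \<and>
     (\<forall>a b. inf a b \<in> I \<longrightarrow> a \<in> I \<or> b \<in> I)"

text \<open>
  A point \<open>x\<close> of the dual space is the prime ideal \<open>I\<^sub>x\<close> itself, so the order is \<open>(\<subseteq>)\<close> and
  \<open>F\<^sub>x = - x\<close>.
\<close>

definition dual_space :: "'a::lattice set set" where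
  "dual_space = {I. prime_ideal I}"

definition mu :: "('a \<Rightarrow> 'd::complete_lattice) \<Rightarrow> 'a set \<Rightarrow> 'd" where
  "mu e x = Sup (e ` x)"

definition nu :: "('a \<Rightarrow> 'd::complete_lattice) \<Rightarrow> 'a set \<Rightarrow> 'd" where
  "nu e x = Inf (e ` (- x))"

definition dual_i :: "('a::bounded_lattice \<Rightarrow> 'a \<Rightarrow> 'a) \<Rightarrow> 'a set \<Rightarrow> 'a set" where
  "dual_i m x = {a. oneg m a \<in> - x}"

text \<open>
  The partial operations are total functions paired with their domains; their values outside the
  domains are irrelevant.
\<close>

definition plus_dom :: "('a::bounded_lattice \<Rightarrow> 'a \<Rightarrow> 'a) \<Rightarrow> ('a set \<times> 'a set) set" where
  "plus_dom m = {(x, y). x \<in> dual_space \<and> y \<in> dual_space \<and> y \<subseteq> dual_i m x}"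

definition dual_plus ::
  "('a::bounded_lattice \<Rightarrow> 'd::complete_lattice) \<Rightarrow> ('a \<Rightarrow> 'a \<Rightarrow> 'a) \<Rightarrow> 'a set \<Rightarrow> 'a set \<Rightarrow> 'a set"
  where "dual_plus e m x y = inv_into dual_space (mu e) (sigma_sharp e m (mu e x) (mu e y))"

definition star_dom :: "('a::bounded_lattice \<Rightarrow> 'a \<Rightarrow> 'a) \<Rightarrow> ('a set \<times> 'a set) set" where
  "star_dom m = {(x, y). x \<in> dual_space \<and> y \<in> dual_space \<and> \<not> dual_i m x \<subseteq> y}"

definition dual_star ::
  "('a::bounded_lattice \<Rightarrow> 'd::complete_lattice) \<Rightarrow> ('a \<Rightarrow> 'a \<Rightarrow> 'a) \<Rightarrow> 'a set \<Rightarrow> 'a set \<Rightarrow> 'a set"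
  where "dual_star e m x y = inv_into dual_space (nu e) (pi_flat e m (nu e x) (nu e y))"

end

(*
  By compactness of the canonical extension, the partial operations of the extended dual space are
    x + y = {a | a \<ominus> b \<in> x for some b \<in> y},   x \<star> y = {a | a \<ominus> b \<in> x for all b \<notin> y}.
  The inequality a \<ominus> (a \<ominus> b) \<le> a \<and> b always holds, and contraposition turns \<not>b \<ominus> (\<not>b \<ominus> a) into
  (a \<oplus> b) \<ominus> b, so condition 1 says a \<and> \<not>b \<le> (a \<oplus> b) \<ominus> b.  By residuation, x' + w \<subseteq> x \<star> y means
  that (a \<oplus> b) \<ominus> c \<in> x for all a \<in> x', b \<in> w, c \<notin> y.  Under condition 1, taking b = c in w - y with
  \<not>b \<notin> x forces x' \<subseteq> x.  If condition 1 fails at a, b, some prime ideal x contains (a \<oplus> b) \<ominus> b but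
  neither a nor \<not>b.  Since the operations preserve meets and joins up to duality, maximal choices of
  x', w and the complement of y with x' + w \<subseteq> x \<star> y are prime, and they refute condition 2.
*)
theory Submission
  imports Defs
begin

section \<open>Compactness and density in canonical extensions\<close>

text \<open>Compactness yields finite subsets; in a down-directed set each of them has a single
  member below it. A nonempty chain is a special case.\<close>

lemma finite_directed_lower_bound:
  fixes G :: "'a::order set"
  assumes "finite S" "S \<subseteq> G" "G \<noteq> {}"
    and "\<And>g h. g \<in> G \<Longrightarrow> h \<in> G \<Longrightarrow> \<exists>k\<in>G. k \<le> g \<and> k \<le> h"
  shows "\<exists>g\<in>G. \<forall>s\<in>S. g \<le> s"
  using assms(1,2)
proof induction
  case empty
  then show ?case using assms(3) by auto
next
  case (insert s S)
  then obtain g where g: "g \<in> G" "\<forall>s\<in>S. g \<le> s" by auto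
  then obtain k where "k \<in> G" "k \<le> g" "k \<le> s" using assms(4)[of g s] insert.prems by auto
  then show ?case using g(2) by (metis insertE order_trans)
qed

lemma finite_directed_upper_bound:
  fixes G :: "'a::order set"
  assumes "finite S" "S \<subseteq> G" "G \<noteq> {}"
    and "\<And>g h. g \<in> G \<Longrightarrow> h \<in> G \<Longrightarrow> \<exists>k\<in>G. g \<le> k \<and> h \<le> k"
  shows "\<exists>g\<in>G. \<forall>s\<in>S. s \<le> g"
  using assms(1,2)
proof induction
  case empty
  then show ?case using assms(3) by auto
next
  case (insert s S)
  then obtain g where g: "g \<in> G" "\<forall>s\<in>S. s \<le> g" by auto
  then obtain k where "k \<in> G" "g \<le> k" "s \<le> k" using assms(4)[of g s] insert.prems by auto
  then show ?case using g(2) by (metis insertE order_trans)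
qed

section \<open>Prime ideals of a bounded lattice\<close>

lemma prime_idealD:
  fixes I :: "'a::bounded_lattice set"
  assumes "I \<in> dual_space"
  shows "bot \<in> I" "top \<notin> I" "a \<le> b \<Longrightarrow> b \<in> I \<Longrightarrow> a \<in> I"
    "sup a b \<in> I \<longleftrightarrow> a \<in> I \<and> b \<in> I" "inf a b \<in> I \<longleftrightarrow> a \<in> I \<or> b \<in> I"
proof -
  have I: "prime_ideal I" using assms by (simp add: dual_space_def)
  then show down: "a \<in> I" if "a \<le> b" "b \<in> I" for a b
    using that unfolding prime_ideal_def by blast
  from I have "I \<noteq> {}" "I \<noteq> UNIV" by (simp_all add: prime_ideal_def)
  then obtain u v where "u \<in> I" "v \<notin> I" by blast
  then show "bot \<in> I" "top \<notin> I" using down[of bot u] down[of v top] by auto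
  show "sup a b \<in> I \<longleftrightarrow> a \<in> I \<and> b \<in> I" using I down unfolding prime_ideal_def
    by (metis sup_ge1 sup_ge2)
  show "inf a b \<in> I \<longleftrightarrow> a \<in> I \<or> b \<in> I" using I down unfolding prime_ideal_def
    by (metis inf_le1 inf_le2)
qed

lemma dual_spaceI:
  fixes I :: "'a::bounded_lattice set"
  assumes "bot \<in> I" "top \<notin> I" "\<And>a b. a \<le> b \<Longrightarrow> b \<in> I \<Longrightarrow> a \<in> I"
    "\<And>a b. a \<in> I \<Longrightarrow> b \<in> I \<Longrightarrow> sup a b \<in> I" "\<And>a b. inf a b \<in> I \<Longrightarrow> a \<notin> I \<Longrightarrow> b \<in> I"
  shows "I \<in> dual_space"
  using assms unfolding dual_space_def prime_ideal_def mem_Collect_eq by (intro conjI) blast+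

context canonical_extension
begin

lemma e_mono: "a \<le> b \<Longrightarrow> e a \<le> e b"
  by (metis e_inf inf.absorb_iff1)

lemma e_le_iff: "e a \<le> e b \<longleftrightarrow> a \<le> b"
proof
  assume "e a \<le> e b"
  then have "e (inf a b) = e a" by (simp add: e_inf inf.absorb1)
  then show "a \<le> b" using inj_e by (metis injD inf.absorb_iff1)
qed (rule e_mono)

text \<open>The finite subsets supplied by compactness have a lower bound in \<open>G\<close> and an
  upper bound in \<open>D\<close>, and \<open>e\<close> reflects the order, so one comparison in the
  algebra suffices.\<close>

lemma compactness_directed:
  assumes "Inf (e ` G) \<le> Sup (e ` D)" "G \<noteq> {}" "D \<noteq> {}"
    and G: "\<And>g h. g \<in> G \<Longrightarrow> h \<in> G \<Longrightarrow> \<exists>k\<in>G. k \<le> g \<and> k \<le> h"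
    and D: "\<And>g h. g \<in> D \<Longrightarrow> h \<in> D \<Longrightarrow> \<exists>k\<in>D. g \<le> k \<and> h \<le> k"
  shows "\<exists>g\<in>G. \<exists>d\<in>D. g \<le> d"
proof -
  from compactness[OF assms(1)] obtain S T where ST: "finite S" "S \<subseteq> G" "finite T" "T \<subseteq> D"
    and le: "Inf (e ` S) \<le> Sup (e ` T)" by blast
  obtain g where g: "g \<in> G" "\<forall>s\<in>S. g \<le> s"
    using finite_directed_lower_bound[OF ST(1,2) assms(2) G] by blast
  obtain d where d: "d \<in> D" "\<forall>s\<in>T. s \<le> d"
    using finite_directed_upper_bound[OF ST(3,4) assms(3) D] by blast
  have "e g \<le> Inf (e ` S)" using g(2) by (auto intro: Inf_greatest e_mono)
  also note le
  also have "Sup (e ` T) \<le> e d" using d(2) by (auto intro: Sup_least e_mono)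
  finally show ?thesis using g d e_le_iff by blast
qed

lemma interpolation:
  assumes "p \<in> filter_elements e" "q \<in> ideal_elements e" "p \<le> q"
  shows "\<exists>a. p \<le> e a \<and> e a \<le> q"
proof -
  obtain S T where p: "p = Inf (e ` S)" and q: "q = Sup (e ` T)"
    using assms unfolding filter_elements_def ideal_elements_def by blast
  \<comment> \<open>The arbitrary \<open>S\<close> and \<open>T\<close> are enlarged to all elements
    above \<open>p\<close> and all elements below \<open>q\<close>. These sets are closed under
    binary meets and joins respectively, hence directed, and contain \<open>top\<close> and
    \<open>bot\<close>.\<close>
  let ?G = "{a. p \<le> e a}" and ?D = "{a. e a \<le> q}"
  have "Inf (e ` ?G) \<le> Inf (e ` S)" using p by (intro Inf_superset_mono) (auto intro: Inf_lower)
  also have "\<dots> \<le> Sup (e ` T)" using assms p q by simp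
  also have "\<dots> \<le> Sup (e ` ?D)" using q by (intro Sup_subset_mono) (auto intro: Sup_upper)
  finally have "\<exists>g\<in>?G. \<exists>d\<in>?D. g \<le> d"
  proof (rule compactness_directed)
    show "?G \<noteq> {}" using e_top by (metis (mono_tags) empty_iff mem_Collect_eq top_greatest)
    show "?D \<noteq> {}" using e_bot by (metis (mono_tags) empty_iff mem_Collect_eq bot_least)
    show "\<exists>k\<in>?G. k \<le> g \<and> k \<le> h" if "g \<in> ?G" "h \<in> ?G" for g h
      using that by (intro bexI[of _ "inf g h"]) (auto simp: e_inf)
    show "\<exists>k\<in>?D. g \<le> k \<and> h \<le> k" if "g \<in> ?D" "h \<in> ?D" for g h
      using that by (intro bexI[of _ "sup g h"]) (auto simp: e_sup)
  qed
  then show ?thesis by (metis (mono_tags) e_mono mem_Collect_eq order_trans)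
qed

lemma filter_elements_bot: "bot \<in> filter_elements e"
proof -
  have "bot = Inf (e ` {bot})" by (simp add: e_bot)
  then show ?thesis unfolding filter_elements_def by blast
qed

lemma ideal_elements_top: "top \<in> ideal_elements e"
proof -
  have "top = Sup (e ` {top})" by (simp add: e_top)
  then show ?thesis unfolding ideal_elements_def by blast
qed

lemma nu_filter_element: "nu e x \<in> filter_elements e"
  unfolding nu_def filter_elements_def by blast

lemma mu_ideal_element: "mu e x \<in> ideal_elements e"
  unfolding mu_def ideal_elements_def by blast

text \<open>A prime ideal is closed under joins, hence up-directed, so some member of
  \<open>G\<close> lies below a member of \<open>x\<close>; and \<open>x\<close> is a
  down-set.\<close>

lemma Inf_e_le_mu:
  assumes "Inf (e ` G) \<le> mu e x" "G \<noteq> {}" "x \<in> dual_space"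
    and "\<And>g h. g \<in> G \<Longrightarrow> h \<in> G \<Longrightarrow> \<exists>k\<in>G. k \<le> g \<and> k \<le> h"
  shows "\<exists>g\<in>G. g \<in> x"
proof -
  have "\<exists>g\<in>G. \<exists>d\<in>x. g \<le> d"
    using assms(1) unfolding mu_def
  proof (rule compactness_directed)
    show "\<exists>k\<in>x. g \<le> k \<and> h \<le> k" if "g \<in> x" "h \<in> x" for g h
      using that prime_idealD(4)[OF assms(3)] by (intro bexI[of _ "sup g h"]) auto
  qed (use assms prime_idealD(1) in blast)+
  then show ?thesis using prime_idealD(3)[OF assms(3)] by blast
qed

text \<open>Order dual of \<open>Inf_e_le_mu\<close>: primality closes \<open>- x\<close> under
  meets, which makes it down-directed.\<close>

lemma nu_le_Sup_e:
  assumes "nu e x \<le> Sup (e ` D)" "D \<noteq> {}" "x \<in> dual_space"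
    and "\<And>g h. g \<in> D \<Longrightarrow> h \<in> D \<Longrightarrow> \<exists>k\<in>D. g \<le> k \<and> h \<le> k"
  shows "\<exists>d\<in>D. d \<notin> x"
proof -
  have "\<exists>g\<in>-x. \<exists>d\<in>D. g \<le> d"
    using assms(1) unfolding nu_def
  proof (rule compactness_directed)
    show "\<exists>k\<in>-x. k \<le> g \<and> k \<le> h" if "g \<in> -x" "h \<in> -x" for g h
      using that prime_idealD(5)[OF assms(3)] by (intro bexI[of _ "inf g h"]) auto
  qed (use assms prime_idealD(2) in blast)+
  then show ?thesis using prime_idealD(3)[OF assms(3)] by blast
qed

section \<open>Points of the dual space inside the canonical extension\<close>

lemma e_le_mu_iff: "x \<in> dual_space \<Longrightarrow> e a \<le> mu e x \<longleftrightarrow> a \<in> x"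
  using Inf_e_le_mu[of "{a}" x] by (auto simp: mu_def intro: Sup_upper)

lemma nu_le_e_iff: "x \<in> dual_space \<Longrightarrow> nu e x \<le> e a \<longleftrightarrow> a \<notin> x"
  using nu_le_Sup_e[of x "{a}"] by (auto simp: nu_def intro: Inf_lower)

lemma inj_on_mu: "inj_on (mu e) dual_space"
  by (rule inj_onI) (metis e_le_mu_iff subsetI subset_antisym)

lemma inj_on_nu: "inj_on (nu e) dual_space"
  by (rule inj_onI) (metis nu_le_e_iff subsetI subset_antisym)

text \<open>
  A cocompact \<open>c\<close> separates \<open>u\<close> from \<open>v\<close>, and by Zorn there is a minimal element
  among those below \<open>u\<close> but not below \<open>c\<close>.
\<close>

lemma join_irreducible_separation:
  fixes u v :: 'd
  assumes "\<not> u \<le> v"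
  shows "\<exists>j. completely_join_irreducible j \<and> j \<le> u \<and> \<not> j \<le> v"
proof -
  obtain C where C: "\<forall>c\<in>C. cocompact_element c" "v = Inf C"
    using doubly_algebraic unfolding doubly_algebraic_def by metis
  then obtain c where c: "c \<in> C" "\<not> u \<le> c" using assms by (meson Inf_greatest)
  then have vc: "v \<le> c" and cc: "cocompact_element c" using C by (auto intro: Inf_lower)
  let ?P = "{d. d \<le> u \<and> \<not> d \<le> c}"
  have "\<exists>m\<in>?P. \<forall>a\<in>?P. m \<ge> a \<longrightarrow> a = m"
  proof (rule predicate_Zorn)
    show "partial_order_on ?P (relation_of (\<ge>) ?P)"
      by (rule partial_order_on_relation_ofI) auto
    fix K assume K: "K \<in> Chains (relation_of (\<ge>) ?P)"
    then have sub: "K \<subseteq> ?P" and chain: "\<And>g h. g \<in> K \<Longrightarrow> h \<in> K \<Longrightarrow> g \<le> h \<or> h \<le> g"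
      unfolding Chains_def relation_of_def by blast+
    show "\<exists>d\<in>?P. \<forall>k\<in>K. k \<ge> d"
    proof (cases "K = {}")
      case False
      \<comment> \<open>The infimum serves as lower bound of the chain: were it below
        \<open>c\<close>, cocompactness and linearity would put a single member of \<open>K\<close>
        below \<open>c\<close>.\<close>
      have "\<not> Inf K \<le> c"
      proof
        assume "Inf K \<le> c"
        then obtain T where T: "finite T" "T \<subseteq> K" "Inf T \<le> c"
          using cc unfolding cocompact_element_def by blast
        obtain k where "k \<in> K" "\<forall>t\<in>T. k \<le> t"
          using finite_directed_lower_bound[OF T(1,2) False] chain by blast
        then have "k \<le> c" using T(3) Inf_greatest[of T k] by (auto intro: order_trans)
        then show False using \<open>k \<in> K\<close> sub by blast
      qed
      moreover have "Inf K \<le> u" using False sub by (auto intro: Inf_lower2)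
      ultimately show ?thesis by (blast intro: Inf_lower)
    qed (use c in auto)
  qed
  then obtain j where j: "j \<le> u" "\<not> j \<le> c" and min: "\<And>d. d \<le> u \<Longrightarrow> \<not> d \<le> c \<Longrightarrow> d \<le> j \<Longrightarrow> d = j"
    by blast
  have "completely_join_irreducible j"
    unfolding completely_join_irreducible_def
  proof (intro allI impI, rule ccontr)
    fix S assume S: "j = Sup S" "j \<notin> S"
    \<comment> \<open>Each \<open>s\<close> lies below \<open>j\<close> and differs from it, so
      minimality of \<open>j\<close> leaves only \<open>s \<le> c\<close>.\<close>
    have "s \<le> c" if "s \<in> S" for s
      using that S min[of s] j(1) by (metis Sup_upper order_trans)
    then show False using j(2) S(1) by (simp add: Sup_least)
  qed
  then show ?thesis using j vc order_trans by blast
qed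

text \<open>Completely join-irreducible elements are filter elements. This is density: every element
  is the join of the filter elements below it.\<close>

lemma filter_element_separation:
  assumes "\<not> u \<le> v"
  shows "\<exists>p\<in>filter_elements e. p \<le> u \<and> \<not> p \<le> v"
  using join_irreducible_separation[OF assms] join_irreducible_meet
  unfolding filter_elements_def by blast

text \<open>A filter element below \<open>v\<close> but not below \<open>mu e x\<close> is a meet of
  elements outside \<open>x\<close>, hence above \<open>nu e x\<close>. Equivalently,
  \<kappa>(\<nu>(x)) \<le> \<mu>(x).\<close>

lemma nu_le_or_le_mu: "nu e x \<le> v \<or> v \<le> mu e x"
proof (rule ccontr)
  assume *: "\<not> ?thesis"
  then obtain p where p: "p \<in> filter_elements e" "p \<le> v" "\<not> p \<le> mu e x"
    using filter_element_separation by blast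
  then obtain S where S: "p = Inf (e ` S)" unfolding filter_elements_def by blast
  have "s \<notin> x" if "s \<in> S" for s
    using that p(3) unfolding S mu_def by (meson Inf_lower Sup_upper imageI order_trans)
  then have "nu e x \<le> p" unfolding nu_def S by (intro Inf_superset_mono) auto
  then show False using * p(2) by auto
qed

text \<open>The point comes from the canonical extension: a completely join-irreducible
  \<open>j\<close> below \<open>e a\<close> but not below \<open>e b\<close> is join-prime by
  distributivity, so the elements \<open>c\<close> with \<open>j \<le> e c\<close> form a prime
  filter.\<close>

lemma prime_ideal_separation:
  fixes a b :: 'a
  assumes "\<not> a \<le> b"
  shows "\<exists>x\<in>dual_space. a \<notin> x \<and> b \<in> x"
proof -
  obtain j where j: "completely_join_irreducible j" "j \<le> e a" "\<not> j \<le> e b"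
    using join_irreducible_separation[of "e a" "e b"] assms e_le_iff by blast
  let ?x = "{c. \<not> j \<le> e c}"
  have "?x \<in> dual_space"
  proof (rule dual_spaceI)
    show "bot \<in> ?x" using j(3) by (auto simp: e_bot intro: order_trans)
    show "sup c d \<in> ?x" if "c \<in> ?x" "d \<in> ?x" for c d
    proof
      show "\<not> j \<le> e (sup c d)"
      proof
        assume "j \<le> e (sup c d)"
        then have "j = Sup {inf j (e c), inf j (e d)}"
          by (simp add: e_sup inf.absorb1 flip: inf_sup_distrib1)
        then have "j \<in> {inf j (e c), inf j (e d)}"
          using j(1) unfolding completely_join_irreducible_def by blast
        then show False using that by (metis inf_le2 insertE mem_Collect_eq singletonD)
      qed
    qed
  qed (use e_top e_inf in \<open>auto intro: order_trans e_mono\<close>)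
  then show ?thesis using j(2,3) by (intro bexI[of _ ?x]) simp_all
qed

end

section \<open>The operations of the extended dual space\<close>

context ominus_algebra
begin

lemma ominus_mono: "a \<le> b \<Longrightarrow> d \<le> c \<Longrightarrow> a \<ominus> c \<le> b \<ominus> d"
  by (metis inf_ominus ominus_sup inf.absorb_iff1 sup.absorb_iff1 le_inf_iff order_refl)

text \<open>The domain condition says exactly that no \<open>b\<close> in \<open>y\<close> puts
  \<open>top\<close> into the set. For joins, two witnesses are replaced by their join, which only
  makes the differences smaller.\<close>

lemma ideal_sum_in_dual_space:
  assumes "(x, y) \<in> plus_dom (\<ominus>)"
  shows "{a. \<exists>b\<in>y. a \<ominus> b \<in> x} \<in> dual_space"
proof -
  have x: "x \<in> dual_space" and y: "y \<in> dual_space" and dom: "\<And>b. b \<in> y \<Longrightarrow> top \<ominus> b \<notin> x"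
    using assms by (auto simp: plus_dom_def dual_i_def oneg_def)
  note X = prime_idealD[OF x] and Y = prime_idealD[OF y]
  show ?thesis
  proof (rule dual_spaceI)
    show "bot \<in> {a. \<exists>b\<in>y. a \<ominus> b \<in> x}" using X(1) Y(1) by (auto simp: bot_ominus)
    show "a \<in> {a. \<exists>b\<in>y. a \<ominus> b \<in> x}" if "a \<le> c" "c \<in> {a. \<exists>b\<in>y. a \<ominus> b \<in> x}" for a c
      using that X(3) ominus_mono[OF that(1) order_refl] by blast
    fix a c
    assume "a \<in> {a. \<exists>b\<in>y. a \<ominus> b \<in> x}" "c \<in> {a. \<exists>b\<in>y. a \<ominus> b \<in> x}"
    then obtain b d where "b \<in> y" "d \<in> y" "a \<ominus> b \<in> x" "c \<ominus> d \<in> x" by blast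
    moreover have "a \<ominus> sup b d \<le> a \<ominus> b" "c \<ominus> sup b d \<le> c \<ominus> d" by (simp_all add: ominus_mono)
    ultimately have "sup b d \<in> y" "sup a c \<ominus> sup b d \<in> x"
      using X(3,4) Y(4) by (auto simp only: sup_ominus)
    then show "sup a c \<in> {a. \<exists>b\<in>y. a \<ominus> b \<in> x}" by blast
  qed (use dom X(5) in \<open>auto simp: inf_ominus\<close>)
qed

text \<open>The domain condition again excludes \<open>top\<close>. For primality, two
  counterexamples are replaced by their meet, which stays outside \<open>y\<close> and only makes
  the differences larger.\<close>

lemma ideal_star_in_dual_space:
  assumes "(x, y) \<in> star_dom (\<ominus>)"
  shows "{a. \<forall>b. b \<notin> y \<longrightarrow> a \<ominus> b \<in> x} \<in> dual_space"
proof -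
  have x: "x \<in> dual_space" and y: "y \<in> dual_space" and dom: "\<exists>b. b \<notin> y \<and> top \<ominus> b \<notin> x"
    using assms by (auto simp: star_dom_def dual_i_def oneg_def)
  note X = prime_idealD[OF x] and Y = prime_idealD[OF y]
  let ?t = "{a. \<forall>b. b \<notin> y \<longrightarrow> a \<ominus> b \<in> x}"
  show ?thesis
  proof (rule dual_spaceI)
    show "a \<in> ?t" if "a \<le> c" "c \<in> ?t" for a c
      using that X(3) ominus_mono[OF that(1) order_refl] by blast
    show "c \<in> ?t" if ac: "inf a c \<in> ?t" "a \<notin> ?t" for a c
    proof (rule ccontr)
      assume "c \<notin> ?t"
      with ac obtain b d where "b \<notin> y" "d \<notin> y" "a \<ominus> b \<notin> x" "c \<ominus> d \<notin> x" by blast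
      moreover have "a \<ominus> b \<le> a \<ominus> inf b d" "c \<ominus> d \<le> c \<ominus> inf b d" by (simp_all add: ominus_mono)
      ultimately have "inf b d \<notin> y" "inf a c \<ominus> inf b d \<notin> x"
        using X(3,5) Y(5) by (auto simp only: inf_ominus)
      then show False using ac by blast
    qed
  qed (use dom X(1,4) in \<open>auto simp: bot_ominus sup_ominus\<close>)
qed

end

locale ominus_algebra_extension =
  ominus_algebra ominus + canonical_extension e
  for ominus :: "'a::{distrib_lattice,bounded_lattice} \<Rightarrow> 'a \<Rightarrow> 'a"  (infixl \<open>\<ominus>\<close> 65)
    and e :: "'a \<Rightarrow> 'd::{complete_lattice,distrib_lattice}"
begin

text \<open>This is the adjunction defining \<open>sigma_sharp\<close>, with its value exhibited as
  \<open>mu e\<close> of a prime ideal. From left to right a single interval of the outer join is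
  tested; conversely the meet over each interval lies below an element of \<open>x\<close>.\<close>

lemma sigma_ext_le_mu_iff:
  assumes dom: "(x, y) \<in> plus_dom (\<ominus>)"
  shows "sigma_ext e (\<ominus>) u (mu e y) \<le> mu e x \<longleftrightarrow> u \<le> mu e {a. \<exists>b\<in>y. a \<ominus> b \<in> x}"
    (is "?L \<le> _ \<longleftrightarrow> u \<le> mu e ?t")
proof
  have x: "x \<in> dual_space" and y: "y \<in> dual_space" using dom by (auto simp: plus_dom_def)
  note X = prime_idealD[OF x] and Y = prime_idealD[OF y]
  have t: "?t \<in> dual_space" using ideal_sum_in_dual_space[OF dom] .
  note T = prime_idealD[OF t]
  {
    assume L: "?L \<le> mu e x"
    show "u \<le> mu e ?t"
    proof (rule ccontr)
      assume "\<not> u \<le> mu e ?t"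
      then obtain p where p: "p \<in> filter_elements e" "p \<le> u" "\<not> p \<le> mu e ?t"
        using filter_element_separation by blast
      \<comment> \<open>The interval from \<open>p\<close> to \<open>top\<close> in the first
        argument and from \<open>bot\<close> to \<open>mu e y\<close> in the second is admissible,
        and the differences over it are down-directed.\<close>
      let ?G = "{a \<ominus> b | a b. e a \<in> {p..top} \<and> e b \<in> {bot..mu e y}}"
      have "Inf (e ` ?G) = Inf {e (a \<ominus> b) | a b. e a \<in> {p..top} \<and> e b \<in> {bot..mu e y}}"
        by (rule arg_cong[where f = Inf]) blast
      also have "\<dots> \<le> ?L"
        unfolding sigma_ext_def using p filter_elements_bot ideal_elements_top mu_ideal_element
        by (intro Sup_upper CollectI exI[of _ p] exI[of _ top] exI[of _ bot] exI[of _ "mu e y"]) auto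
      also note L
      finally have "\<exists>g\<in>?G. g \<in> x"
      proof (rule Inf_e_le_mu)
        have "top \<ominus> bot \<in> ?G" by (rule CollectI) (use e_top e_bot in fastforce)
        then show "?G \<noteq> {}" by blast
        show "\<exists>k\<in>?G. k \<le> g \<and> k \<le> h" if gh: "g \<in> ?G" "h \<in> ?G" for g h
        proof -
          obtain a b c d where gh: "g = a \<ominus> b" "h = c \<ominus> d" "p \<le> e a" "p \<le> e c"
            "e b \<le> mu e y" "e d \<le> mu e y" using gh by auto
          have "e (inf a c) \<in> {p..top}" "e (sup b d) \<in> {bot..mu e y}"
            using gh by (auto simp: e_inf e_sup)
          then have "inf a c \<ominus> sup b d \<in> ?G" by blast
          moreover have "inf a c \<ominus> sup b d \<le> g" "inf a c \<ominus> sup b d \<le> h"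
            unfolding gh by (auto intro: ominus_mono)
          ultimately show ?thesis by blast
        qed
      qed (rule x)
      then obtain a b where "p \<le> e a" "b \<in> y" "a \<ominus> b \<in> x" using e_le_mu_iff[OF y] by auto
      then have "e a \<le> mu e ?t" using e_le_mu_iff[OF t] by blast
      then show False using \<open>p \<le> e a\<close> p(3) by auto
    qed
  }
  assume u: "u \<le> mu e ?t"
  show "?L \<le> mu e x"
    unfolding sigma_ext_def
  proof (rule Sup_least, clarify)
    fix p1 q1 p2 q2
    assume pq: "p1 \<in> filter_elements e" "p2 \<in> filter_elements e" "q1 \<in> ideal_elements e"
      "q2 \<in> ideal_elements e" "p1 \<le> u" "u \<le> q1" "p2 \<le> mu e y" "mu e y \<le> q2"
    \<comment> \<open>Here \<open>a1\<close> respects the bound \<open>q1\<close>, \<open>a2\<close>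
      lies in the ideal, and both are above \<open>p1\<close>; their meet has all three properties.
      Likewise \<open>sup b b2\<close> stays in \<open>y\<close> and lies above
      \<open>p2\<close>.\<close>
    obtain a1 where a1: "p1 \<le> e a1" "e a1 \<le> q1" using interpolation pq order_trans by blast
    obtain a2 where a2: "p1 \<le> e a2" "a2 \<in> ?t"
      using interpolation[OF pq(1) mu_ideal_element, of ?t] pq u e_le_mu_iff[OF t]
      by (meson order_trans)
    then have "inf a1 a2 \<in> ?t" using T(5) by blast
    then obtain b where b: "b \<in> y" "inf a1 a2 \<ominus> b \<in> x" by blast
    obtain b2 where b2: "p2 \<le> e b2" "b2 \<in> y"
      using interpolation[OF pq(2) mu_ideal_element, of y] pq e_le_mu_iff[OF y] by blast
    have "sup b b2 \<in> y" using b b2 Y(4) by blast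
    then have "e (sup b b2) \<le> q2" using pq(8) e_le_mu_iff[OF y] order_trans by blast
    moreover have "p2 \<le> e (sup b b2)" using b2 by (auto simp: e_sup intro: le_supI2)
    moreover have "e (inf a1 a2) \<in> {p1..q1}" using a1 a2 by (auto simp: e_inf intro: le_infI1)
    ultimately have "Inf {e (a \<ominus> b) | a b. e a \<in> {p1..q1} \<and> e b \<in> {p2..q2}}
      \<le> e (inf a1 a2 \<ominus> sup b b2)"
      by (intro Inf_lower) auto
    also have "inf a1 a2 \<ominus> sup b b2 \<in> x" using b X(3) ominus_mono by (meson order_refl sup_ge1)
    then have "e (inf a1 a2 \<ominus> sup b b2) \<le> mu e x" using e_le_mu_iff[OF x] by blast
    finally show "Inf {e (a \<ominus> b) | a b. e a \<in> {p1..q1} \<and> e b \<in> {p2..q2}} \<le> mu e x" .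
  qed
qed

text \<open>Order dual of \<open>sigma_ext_le_mu_iff\<close> in the outer operations. Since no
  separation by ideal elements is at hand, \<open>nu_le_or_le_mu\<close> turns the failure of
  \<open>nu e ?t \<le> v\<close> into the upper bound \<open>mu e ?t\<close> for
  \<open>v\<close>.\<close>

lemma nu_le_pi_ext_iff:
  assumes dom: "(x, y) \<in> star_dom (\<ominus>)"
  shows "nu e x \<le> pi_ext e (\<ominus>) v (nu e y) \<longleftrightarrow> nu e {a. \<forall>b. b \<notin> y \<longrightarrow> a \<ominus> b \<in> x} \<le> v"
    (is "_ \<le> ?R \<longleftrightarrow> nu e ?t \<le> v")
proof
  have x: "x \<in> dual_space" and y: "y \<in> dual_space" using dom by (auto simp: star_dom_def)
  note X = prime_idealD[OF x] and Y = prime_idealD[OF y]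
  have t: "?t \<in> dual_space" using ideal_star_in_dual_space[OF dom] .
  note T = prime_idealD[OF t]
  {
    assume R: "nu e x \<le> ?R"
    show "nu e ?t \<le> v"
    proof (rule ccontr)
      assume "\<not> nu e ?t \<le> v"
      then have v: "v \<le> mu e ?t" using nu_le_or_le_mu by blast
      let ?D = "{a \<ominus> b | a b. e a \<in> {bot..mu e ?t} \<and> e b \<in> {nu e y..top}}"
      note R
      also have "?R \<le> Sup {e (a \<ominus> b) | a b. e a \<in> {bot..mu e ?t} \<and> e b \<in> {nu e y..top}}"
        unfolding pi_ext_def
        using v filter_elements_bot ideal_elements_top mu_ideal_element nu_filter_element
        by (intro Inf_lower CollectI exI[of _ bot] exI[of _ "mu e ?t"] exI[of _ "nu e y"] exI[of _ top])
          auto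
      also have "\<dots> = Sup (e ` ?D)" by (rule arg_cong[where f = Sup]) blast
      finally have "\<exists>d\<in>?D. d \<notin> x"
      proof (rule nu_le_Sup_e)
        have "bot \<ominus> top \<in> ?D" by (rule CollectI) (use e_top e_bot in fastforce)
        then show "?D \<noteq> {}" by blast
        show "\<exists>k\<in>?D. g \<le> k \<and> h \<le> k" if gh: "g \<in> ?D" "h \<in> ?D" for g h
        proof -
          obtain a b c d where gh: "g = a \<ominus> b" "h = c \<ominus> d" "nu e y \<le> e b" "nu e y \<le> e d"
            "e a \<le> mu e ?t" "e c \<le> mu e ?t" using gh by auto
          have "e (sup a c) \<in> {bot..mu e ?t}" "e (inf b d) \<in> {nu e y..top}"
            using gh by (auto simp: e_inf e_sup)
          then have "sup a c \<ominus> inf b d \<in> ?D" by blast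
          moreover have "g \<le> sup a c \<ominus> inf b d" "h \<le> sup a c \<ominus> inf b d"
            unfolding gh by (auto intro: ominus_mono)
          ultimately show ?thesis by blast
        qed
      qed (rule x)
      then obtain a b where "e a \<le> mu e ?t" "nu e y \<le> e b" "a \<ominus> b \<notin> x" by auto
      then show False using e_le_mu_iff[OF t] nu_le_e_iff[OF y] by blast
    qed
  }
  assume v: "nu e ?t \<le> v"
  show "nu e x \<le> ?R"
    unfolding pi_ext_def
  proof (rule Inf_greatest, clarify)
    fix p1 q1 p2 q2
    assume pq: "p1 \<in> filter_elements e" "p2 \<in> filter_elements e" "q1 \<in> ideal_elements e"
      "q2 \<in> ideal_elements e" "p1 \<le> v" "v \<le> q1" "p2 \<le> nu e y" "nu e y \<le> q2"
    \<comment> \<open>Here \<open>a1\<close> respects the bound \<open>p1\<close>, \<open>a2\<close>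
      lies outside the ideal, and both are below \<open>q1\<close>; their join has all three
      properties.\<close>
    obtain a1 where a1: "p1 \<le> e a1" "e a1 \<le> q1" using interpolation pq order_trans by blast
    obtain a2 where a2: "e a2 \<le> q1" "a2 \<notin> ?t"
      using interpolation[OF nu_filter_element pq(3), of ?t] pq v nu_le_e_iff[OF t]
      by (meson order_trans)
    then have "sup a1 a2 \<notin> ?t" using T(4) by blast
    then obtain b where b: "b \<notin> y" "sup a1 a2 \<ominus> b \<notin> x" by blast
    obtain b2 where b2: "e b2 \<le> q2" "b2 \<notin> y"
      using interpolation[OF nu_filter_element pq(4), of y] pq nu_le_e_iff[OF y] by blast
    have "inf b b2 \<notin> y" using b b2 Y(5) by blast
    then have "p2 \<le> e (inf b b2)" using pq(7) nu_le_e_iff[OF y] order_trans by blast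
    moreover have "e (inf b b2) \<le> q2" using b2 by (auto simp: e_inf intro: le_infI2)
    moreover have "e (sup a1 a2) \<in> {p1..q1}" using a1 a2 by (auto simp: e_sup intro: le_supI1)
    ultimately have le: "e (sup a1 a2 \<ominus> inf b b2)
      \<le> Sup {e (a \<ominus> b) | a b. e a \<in> {p1..q1} \<and> e b \<in> {p2..q2}}"
      by (intro Sup_upper) auto
    have "sup a1 a2 \<ominus> inf b b2 \<notin> x" using b X(3) ominus_mono by (meson order_refl inf_le1)
    then have "nu e x \<le> e (sup a1 a2 \<ominus> inf b b2)" using nu_le_e_iff[OF x] by blast
    also note le
    finally show "nu e x \<le> Sup {e (a \<ominus> b) | a b. e a \<in> {p1..q1} \<and> e b \<in> {p2..q2}}" .
  qed
qed

text \<open>Antisymmetry makes the element satisfying the adjunction unique, and injectivity of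
  \<open>mu e\<close> on points recovers the ideal itself.\<close>

lemma dual_plus_eq:
  assumes dom: "(x, y) \<in> plus_dom (\<ominus>)"
  shows "dual_plus e (\<ominus>) x y = {a. \<exists>b\<in>y. a \<ominus> b \<in> x}"
proof -
  have "sigma_sharp e (\<ominus>) (mu e x) (mu e y) = mu e {a. \<exists>b\<in>y. a \<ominus> b \<in> x}"
    unfolding sigma_sharp_def sigma_ext_le_mu_iff[OF dom]
    by (rule the_equality) (auto intro: order_antisym)
  then show ?thesis
    unfolding dual_plus_def using inv_into_f_f[OF inj_on_mu ideal_sum_in_dual_space[OF dom]] by simp
qed

lemma dual_star_eq:
  assumes dom: "(x, y) \<in> star_dom (\<ominus>)"
  shows "dual_star e (\<ominus>) x y = {a. \<forall>b. b \<notin> y \<longrightarrow> a \<ominus> b \<in> x}"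
proof -
  have "pi_flat e (\<ominus>) (nu e x) (nu e y) = nu e {a. \<forall>b. b \<notin> y \<longrightarrow> a \<ominus> b \<in> x}"
    unfolding pi_flat_def nu_le_pi_ext_iff[OF dom]
    by (rule the_equality) (auto intro: order_antisym)
  then show ?thesis
    unfolding dual_star_def using inv_into_f_f[OF inj_on_nu ideal_star_in_dual_space[OF dom]] by simp
qed

end

section \<open>The correspondence\<close>

locale involutive_ominus_algebra = ominus_algebra ominus
  for ominus :: "'a::{distrib_lattice,bounded_lattice} \<Rightarrow> 'a \<Rightarrow> 'a"  (infixl \<open>\<ominus>\<close> 65) +
  assumes invol: "oneg (\<ominus>) (oneg (\<ominus>) a) = a"
    and residual: "a \<le> oplus (\<ominus>) b c \<longleftrightarrow> a \<ominus> c \<le> b"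
    and oplus_commute: "oplus (\<ominus>) a b = oplus (\<ominus>) b a"
begin

abbreviation neg :: "'a \<Rightarrow> 'a" where "neg \<equiv> oneg (\<ominus>)"

abbreviation plus :: "'a \<Rightarrow> 'a \<Rightarrow> 'a"  (infixl \<open>\<oplus>\<close> 65) where "(\<oplus>) \<equiv> oplus (\<ominus>)"

section \<open>De Morgan laws, residuation and contraposition\<close>

lemma neg_inf: "neg (inf a b) = sup (neg a) (neg b)"
  and neg_sup: "neg (sup a b) = inf (neg a) (neg b)"
  by (simp_all add: oneg_def ominus_inf ominus_sup)

lemma neg_bot: "neg bot = top" and neg_top: "neg top = bot"
  by (simp_all add: oneg_def ominus_bot ominus_top)

lemma neg_oplus: "neg (a \<oplus> b) = neg a \<ominus> b"
  by (simp add: oplus_def invol)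

text \<open>Both sides are negations of a sum, of \<open>neg a \<oplus> b\<close> and of
  \<open>b \<oplus> neg a\<close>.\<close>

lemma ominus_contrapositive: "a \<ominus> b = neg b \<ominus> neg a"
  by (metis invol neg_oplus oplus_commute)

lemma oplus_inf_left: "inf a b \<oplus> c = inf (a \<oplus> c) (b \<oplus> c)"
  and oplus_sup_left: "sup a b \<oplus> c = sup (a \<oplus> c) (b \<oplus> c)"
  by (simp_all add: oplus_def neg_inf neg_sup inf_ominus sup_ominus)

lemma oplus_inf_right: "a \<oplus> inf b c = inf (a \<oplus> b) (a \<oplus> c)"
  and oplus_sup_right: "a \<oplus> sup b c = sup (a \<oplus> b) (a \<oplus> c)"
  by (simp_all add: oplus_def neg_inf neg_sup ominus_inf ominus_sup)

lemma oplus_mono: "a \<le> b \<Longrightarrow> c \<le> d \<Longrightarrow> a \<oplus> c \<le> b \<oplus> d"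
  by (metis oplus_sup_left oplus_sup_right sup.absorb_iff2 sup.cobounded1 order_trans)

lemma oplus_bot: "a \<oplus> bot = a"
  by (simp add: oplus_def ominus_bot invol)

lemma top_oplus: "top \<oplus> a = top" and oplus_top: "a \<oplus> top = top"
  by (simp_all add: oplus_def neg_top bot_ominus ominus_top neg_bot)

lemma neg_oplus_self: "neg a \<oplus> a = top"
  using residual[of top "neg a" a] by (simp add: oneg_def top.extremum_unique)

text \<open>The bound by \<open>b\<close> is residuation applied to
  \<open>a \<le> (a \<ominus> b) \<oplus> b\<close> after commuting the sum; the bound by
  \<open>a\<close> is antitonicity in the second argument.\<close>

lemma ominus_ominus_le: "a \<ominus> (a \<ominus> b) \<le> inf a b"
  using residual oplus_commute ominus_mono[of a a bot "a \<ominus> b"]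
  by (metis bot_least le_inf_iff ominus_bot order_refl)

lemma ominus_ominus_eq: "a \<ominus> (a \<ominus> b) = (b \<oplus> neg a) \<ominus> neg a"
  by (metis invol neg_oplus ominus_contrapositive)

lemma divisible_iff:
  "(\<forall>a b. inf a b = a \<ominus> (a \<ominus> b)) \<longleftrightarrow> (\<forall>a b. inf a (neg b) \<le> (a \<oplus> b) \<ominus> b)"
proof (intro iffI allI)
  fix a b
  assume "\<forall>a b. inf a b = a \<ominus> (a \<ominus> b)"
  then show "inf a (neg b) \<le> (a \<oplus> b) \<ominus> b"
    using ominus_ominus_eq[of "neg b" a] by (metis inf.commute invol order_refl)
next
  fix a b
  assume "\<forall>a b. inf a (neg b) \<le> (a \<oplus> b) \<ominus> b"
  then have "inf b a \<le> a \<ominus> (a \<ominus> b)"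
    using ominus_ominus_eq[of a b] by (metis invol)
  then show "inf a b = a \<ominus> (a \<ominus> b)"
    using ominus_ominus_le by (simp add: inf.commute order_antisym)
qed

text \<open>By residuation \<open>a \<oplus> b\<close> is the largest \<open>d\<close> with
  \<open>d \<ominus> b \<le> a\<close>. Hence the left-hand ideal is the down-closure of the sums
  \<open>a \<oplus> b\<close> with \<open>a\<close> in \<open>x'\<close> and \<open>b\<close> in
  \<open>w\<close>, and the inclusion can be tested on these.\<close>

lemma ideal_sum_subset_star_iff:
  assumes "x \<in> dual_space" "x' \<in> dual_space"
  shows "{a. \<exists>b\<in>w. a \<ominus> b \<in> x'} \<subseteq> {a. \<forall>b. b \<notin> y \<longrightarrow> a \<ominus> b \<in> x} \<longleftrightarrow>
    (\<forall>a\<in>x'. \<forall>b\<in>w. \<forall>c. c \<notin> y \<longrightarrow> (a \<oplus> b) \<ominus> c \<in> x)" (is "?L \<longleftrightarrow> ?R")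
proof
  assume ?L
  moreover have "(a \<oplus> b) \<ominus> b \<in> x'" if "a \<in> x'" for a b
    using that residual prime_idealD(3)[OF assms(2)] by blast
  ultimately show ?R by blast
next
  assume R: ?R
  have "d \<ominus> c \<in> x" if "b \<in> w" "d \<ominus> b \<in> x'" "c \<notin> y" for b c d
  proof -
    have "d \<ominus> c \<le> ((d \<ominus> b) \<oplus> b) \<ominus> c" using residual by (intro ominus_mono) auto
    then show ?thesis using R that prime_idealD(3)[OF assms(1)] by blast
  qed
  then show ?L by blast
qed

lemma subset_if_divisible:
  assumes div: "\<And>a b. inf a (neg b) \<le> (a \<oplus> b) \<ominus> b"
    and dom: "(x, y) \<in> star_dom (\<ominus>)" and "x' \<in> dual_space" "w \<in> dual_space" "\<not> w \<subseteq> y"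
    and sub: "\<forall>a\<in>x'. \<forall>b\<in>w. \<forall>c. c \<notin> y \<longrightarrow> (a \<oplus> b) \<ominus> c \<in> x"
  shows "x' \<subseteq> x"
proof
  fix a assume a: "a \<in> x'"
  have x: "x \<in> dual_space" and y: "y \<in> dual_space" using dom by (auto simp: star_dom_def)
  obtain c where c: "c \<notin> y" "neg c \<notin> x" using dom by (auto simp: star_dom_def dual_i_def)
  obtain b where b: "b \<in> w" "b \<notin> y" using assms(5) by blast
  \<comment> \<open>One element has to serve twice: the meet stays in \<open>w\<close> and, by
    primality, outside \<open>y\<close>, while its negation dominates \<open>neg c\<close> and so
    stays outside \<open>x\<close>.\<close>
  let ?b = "inf b c"
  have "?b \<in> w" "?b \<notin> y" using b c prime_idealD(5) y assms(4) by blast+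
  then have "inf a (neg ?b) \<in> x" using sub a div prime_idealD(3)[OF x] by blast
  moreover have "neg ?b \<notin> x" using c prime_idealD(4)[OF x] by (simp add: neg_inf)
  ultimately show "a \<in> x" using prime_idealD(5)[OF x] by blast
qed

text \<open>
  Each of \<open>x'\<close>, \<open>w\<close> and \<open>- y\<close> is chosen in turn as large as possible; primality of the later two
  comes from joining the witnesses taken from the ones already chosen.
\<close>

lemma refuting_primes:
  assumes x: "x \<in> dual_space" and ab: "(a \<oplus> b) \<ominus> b \<in> x" "a \<notin> x" "neg b \<notin> x"
  obtains x' w y where "x' \<in> dual_space" "w \<in> dual_space" "y \<in> dual_space" "a \<in> x'"
    "b \<in> w" "b \<notin> y" "w \<subseteq> dual_i (\<ominus>) x'"
    "\<forall>a\<in>x'. \<forall>b\<in>w. \<forall>c. c \<notin> y \<longrightarrow> (a \<oplus> b) \<ominus> c \<in> x"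
proof -
  note X = prime_idealD[OF x]
  \<comment> \<open>The set \<open>x'\<close> is the largest compatible with \<open>b\<close> alone
    in \<open>w\<close> and outside \<open>y\<close>; then \<open>w\<close> is the largest for this
    \<open>x'\<close> and \<open>b\<close> outside \<open>y\<close>, and \<open>- y\<close> the
    largest for both. In the definition of \<open>y\<close> the letter \<open>b\<close> is
    rebound.\<close>
  define x' where "x' = {a. (a \<oplus> b) \<ominus> b \<in> x}"
  define w where "w = {c. \<forall>a\<in>x'. (a \<oplus> c) \<ominus> b \<in> x}"
  define y where "y = {c. \<exists>a\<in>x'. \<exists>b\<in>w. (a \<oplus> b) \<ominus> c \<notin> x}"
  have top_b: "top \<ominus> b \<notin> x" using ab(3) by (simp add: oneg_def)
  have bot_oplus: "bot \<oplus> c = c" for c by (metis oplus_bot oplus_commute)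
  \<comment> \<open>This puts \<open>bot\<close> into \<open>x'\<close>. The map sending
    \<open>a\<close> to \<open>(a \<oplus> b) \<ominus> b\<close> preserves binary meets and joins
    and sends \<open>top\<close> to \<open>neg b\<close>, so the preimage of \<open>x\<close> is
    prime.\<close>
  have "b \<ominus> b = bot"
    using residual[of b bot b] by (simp add: bot_oplus bot.extremum_unique)
  then have x': "x' \<in> dual_space"
    unfolding x'_def
  proof (intro dual_spaceI)
    show "c \<in> {a. (a \<oplus> b) \<ominus> b \<in> x}" if "c \<le> d" "d \<in> {a. (a \<oplus> b) \<ominus> b \<in> x}" for c d
      using that X(3) ominus_mono[OF oplus_mono[OF that(1) order_refl] order_refl] by blast
  qed (use X(1,4,5) top_b in \<open>auto simp: bot_oplus top_oplus oplus_sup_left sup_ominus oplus_inf_left inf_ominus\<close>)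
  note X' = prime_idealD[OF x']
  have w: "w \<in> dual_space"
  proof (rule dual_spaceI)
    have "(c \<oplus> bot) \<ominus> b \<le> (c \<oplus> b) \<ominus> b" for c by (intro ominus_mono oplus_mono) auto
    then show "bot \<in> w" using X(3) by (auto simp: w_def x'_def)
    show "top \<notin> w" using top_b X'(1) by (auto simp: w_def oplus_top)
    show "c \<in> w" if "c \<le> d" "d \<in> w" for c d
      using that X(3) ominus_mono[OF oplus_mono[OF order_refl that(1)] order_refl]
      unfolding w_def by blast
    show "sup c d \<in> w" if "c \<in> w" "d \<in> w" for c d
      using that X(4) by (auto simp: w_def oplus_sup_right sup_ominus)
    fix c d
    assume cd: "inf c d \<in> w" "c \<notin> w"
    show "d \<in> w"
    proof (rule ccontr)
      assume "d \<notin> w"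
      with cd obtain a1 a2 where a: "a1 \<in> x'" "a2 \<in> x'" "(a1 \<oplus> c) \<ominus> b \<notin> x" "(a2 \<oplus> d) \<ominus> b \<notin> x"
        unfolding w_def by blast
      \<comment> \<open>With the common witness \<open>sup a1 a2\<close> both differences remain
        outside \<open>x\<close>, and so does their meet because \<open>x\<close> is prime.\<close>
      then have "sup a1 a2 \<in> x'" "(sup a1 a2 \<oplus> inf c d) \<ominus> b \<notin> x"
        using X(4,5) X'(4) by (auto simp: oplus_inf_right inf_ominus oplus_sup_left sup_ominus)
      then show False using cd unfolding w_def by blast
    qed
  qed
  note W = prime_idealD[OF w]
  have ax': "a \<in> x'" and bw: "b \<in> w" and b_y: "b \<notin> y" using ab by (auto simp: x'_def w_def y_def)
  have y: "y \<in> dual_space"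
  proof (rule dual_spaceI)
    \<comment> \<open>The expression equals \<open>a\<close>, which lies outside \<open>x\<close>;
      \<open>a\<close> in \<open>x'\<close> and \<open>bot\<close> in \<open>w\<close> are the
      witnesses.\<close>
    have "(a \<oplus> bot) \<ominus> bot \<notin> x" using ab by (simp add: oplus_bot ominus_bot)
    then show "bot \<in> y" unfolding y_def using ax' W(1) by blast
    show "top \<notin> y" using X(1) by (auto simp: y_def ominus_top)
    show "c \<in> y" if "c \<le> d" "d \<in> y" for c d
      using that X(3) ominus_mono[OF order_refl that(1)] unfolding y_def by blast
    show "sup c d \<in> y" if cd: "c \<in> y" "d \<in> y" for c d
    proof -
      from cd obtain a1 b1 a2 b2 where a: "a1 \<in> x'" "a2 \<in> x'" "b1 \<in> w" "b2 \<in> w"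
        and n: "(a1 \<oplus> b1) \<ominus> c \<notin> x" "(a2 \<oplus> b2) \<ominus> d \<notin> x"
        unfolding y_def by blast
      have le: "(a1 \<oplus> b1) \<ominus> c \<le> (sup a1 a2 \<oplus> sup b1 b2) \<ominus> c"
        "(a2 \<oplus> b2) \<ominus> d \<le> (sup a1 a2 \<oplus> sup b1 b2) \<ominus> d"
        by (intro ominus_mono oplus_mono; simp)+
      have "(sup a1 a2 \<oplus> sup b1 b2) \<ominus> sup c d \<notin> x"
        using X(3)[OF le(1)] X(3)[OF le(2)] n X(5) by (auto simp: ominus_sup)
      moreover have "sup a1 a2 \<in> x'" "sup b1 b2 \<in> w" using a X'(4) W(4) by blast+
      ultimately show ?thesis unfolding y_def by blast
    qed
    show "d \<in> y" if "inf c d \<in> y" "c \<notin> y" for c d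
      using that X(4) by (auto simp: y_def ominus_inf)
  qed
  \<comment> \<open>If \<open>neg c\<close> were in \<open>x'\<close> for some \<open>c\<close> in
    \<open>w\<close>, then \<open>neg c \<oplus> c = top\<close> would force
    \<open>top \<ominus> b\<close>, that is \<open>neg b\<close>, into \<open>x\<close>.\<close>
  have "w \<subseteq> dual_i (\<ominus>) x'"
    using top_b by (auto simp: w_def dual_i_def) (metis neg_oplus_self)
  then show thesis by (rule that[OF x' w y ax' bw b_y]) (auto simp: y_def)
qed

end

theorem proposition4p3:
  fixes ominus :: "'a::{distrib_lattice,bounded_lattice} \<Rightarrow> 'a \<Rightarrow> 'a"  (infixl \<open>\<ominus>\<close> 65)
    and e :: "'a \<Rightarrow> 'd::{complete_lattice,distrib_lattice}"
  assumes "ominus_algebra (\<ominus>)"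
    and "canonical_extension e"
    and "\<forall>a. oneg (\<ominus>) (oneg (\<ominus>) a) = a"
    and "\<forall>a b c. a \<le> oplus (\<ominus>) b c \<longleftrightarrow> a \<ominus> c \<le> b"
    and "\<forall>a b. oplus (\<ominus>) a b = oplus (\<ominus>) b a"
  shows "(\<forall>a b. inf a b = a \<ominus> (a \<ominus> b)) \<longleftrightarrow>
    (\<forall>x\<in>dual_space. \<forall>x'\<in>dual_space. \<forall>y\<in>dual_space.
       (x, y) \<in> star_dom (\<ominus>) \<longrightarrow>
       (\<exists>w\<in>dual_space. \<not> w \<subseteq> y \<and> (x', w) \<in> plus_dom (\<ominus>) \<and>
          dual_plus e (\<ominus>) x' w \<subseteq> dual_star e (\<ominus>) x y) \<longrightarrow>
       x' \<subseteq> x)"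
proof -
  interpret ominus_algebra_extension "(\<ominus>)" e
    using assms(1,2) by (simp add: ominus_algebra_extension_def)
  interpret involutive_ominus_algebra "(\<ominus>)"
    using assms by unfold_locales auto
  have sub_iff: "dual_plus e (\<ominus>) x' w \<subseteq> dual_star e (\<ominus>) x y \<longleftrightarrow>
      (\<forall>a\<in>x'. \<forall>b\<in>w. \<forall>c. c \<notin> y \<longrightarrow> (a \<oplus> b) \<ominus> c \<in> x)"
    if "(x, y) \<in> star_dom (\<ominus>)" "(x', w) \<in> plus_dom (\<ominus>)" for x x' w y
    using that ideal_sum_subset_star_iff[of x x' w y]
    by (simp add: dual_plus_eq dual_star_eq plus_dom_def star_dom_def)
  show ?thesis (is "_ \<longleftrightarrow> ?R")
    unfolding divisible_iff
  proof
    assume div: "\<forall>a b. inf a (neg b) \<le> (a \<oplus> b) \<ominus> b"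
    show ?R
    proof (intro ballI impI, elim bexE conjE)
      fix x x' y w
      assume *: "x' \<in> dual_space" "(x, y) \<in> star_dom (\<ominus>)" "w \<in> dual_space" "\<not> w \<subseteq> y"
        "(x', w) \<in> plus_dom (\<ominus>)" "dual_plus e (\<ominus>) x' w \<subseteq> dual_star e (\<ominus>) x y"
      show "x' \<subseteq> x"
        by (rule subset_if_divisible[OF div[rule_format] *(2,1,3,4)])
          (rule sub_iff[OF *(2,5), THEN iffD1, OF *(6)])
    qed
  next
    assume R: ?R
    show "\<forall>a b. inf a (neg b) \<le> (a \<oplus> b) \<ominus> b"
    proof (intro allI, rule ccontr)
      fix a b
      assume "\<not> inf a (neg b) \<le> (a \<oplus> b) \<ominus> b"
      then obtain x where x: "x \<in> dual_space" "(a \<oplus> b) \<ominus> b \<in> x" "inf a (neg b) \<notin> x"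
        using prime_ideal_separation by blast
      then have a: "a \<notin> x" "neg b \<notin> x" using prime_idealD(5) by blast+
      obtain x' w y where xwy: "x' \<in> dual_space" "w \<in> dual_space" "y \<in> dual_space" "a \<in> x'"
        "b \<in> w" "b \<notin> y" "w \<subseteq> dual_i (\<ominus>) x'"
        "\<forall>a\<in>x'. \<forall>b\<in>w. \<forall>c. c \<notin> y \<longrightarrow> (a \<oplus> b) \<ominus> c \<in> x"
        using refuting_primes[OF x(1,2) a] .
      \<comment> \<open>The element \<open>b\<close> is in \<open>dual_i (\<ominus>) x\<close>
        because \<open>neg b\<close> is outside \<open>x\<close>, but it is not in
        \<open>y\<close>.\<close>
      have dom: "(x, y) \<in> star_dom (\<ominus>)" "(x', w) \<in> plus_dom (\<ominus>)"
        using xwy x a by (auto simp: star_dom_def plus_dom_def dual_i_def)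
      have "dual_plus e (\<ominus>) x' w \<subseteq> dual_star e (\<ominus>) x y" using sub_iff[OF dom] xwy(8) by blast
      moreover have "\<not> w \<subseteq> y" using xwy by blast
      ultimately have "x' \<subseteq> x" using R xwy x(1) dom by blast
      then show False using xwy a by blast
    qed
  qed
qed

end
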